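(* Let $X_1,X_2$ be compact Hausdorff spaces and let $\mathcal{A}_1,\mathcal{A}_2$ be unital primitive $C^*$-algebras. Then a map $J:C(X_1,\mathcal{A}_1)\to C(X_2,\mathcal{A}_2)$ is a Jordan $*$-isomorphism if and only if there exist a homeomorphism $\varphi$ from $X_2$ onto $X_1$ and a Jordan $*$-isomorphism $V_y:\mathcal{A}_1\to\mathcal{A}_2$ for each $y\in X_2$, such that the maps $X_2\ni y\mapsto V_y$ and $X_1\ni x\mapsto V^{-1}_{\varphi^{-1}(x)}$ are continuous with respect to the strong operator topology, and $$JF(y)=V_y(F(\varphi(y)))$$ for all $F\in C(X_1,\mathcal{A}_1)$ and $y\in X_2$.
   Context: For a compact Hausdorff space $X$ and a unital $C^*$-algebra $\mathcal{A}$, $C(X,\mathcal{A})$ is the unital $C^*$-algebra of all continuous maps $F:X\to\mathcal{A}$ with pointwise operations and norm $\|F\|=\sup_{x\in X}\|F(x)\|_{\mathcal{A}}$. A $C^*$-algebra is called primitive if its zero ideal is primitive, i.e. if it has a faithful non-zero irreducible representation. The Jordan product in a $*$-algebra is $a\circ b=\frac{ab+ba}{2}$. A Jordan $*$-homomorphism between $*$-algebras is a (complex) linear map $J$ with $J(a\circ b)=J(a)\circ J(b)$ for all $a,b$ and $J(a^* )=J(a)^*$ for all $a$. A Jordan $*$-isomorphism is a bijective Jordan $*$-homomorphism. Continuity with respect to the strong operator topology of $y\mapsto V_y$ means that for every $a\in\mathcal{A}_1$ the map $y\mapsto V_y(a)$ is continuous into $\mathcal{A}_2$ with its norm; likewise,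 for $x\mapsto V^{-1}_{\varphi^{-1}(x)}$ it means that for every $a\in\mathcal{A}_2$ the map $x\mapsto V^{-1}_{\varphi^{-1}(x)}(a)$ is continuous into $\mathcal{A}_1$ with its norm. Here $V^{-1}_{\varphi^{-1}(x)}$ is the inverse of the bijection $V_{\varphi^{-1}(x)}$. *)

theory Defs
  imports "HOL-Analysis.Analysis"
begin

class complex_vector = ab_group_add +
  fixes scaleC :: "complex \<Rightarrow> 'a \<Rightarrow> 'a"  (infixr \<open>*\<^sub>C\<close> 75)
  assumes scaleC_add_right: "a *\<^sub>C (x + y) = a *\<^sub>C x + a *\<^sub>C y"
    and scaleC_add_left: "(a + b) *\<^sub>C x = a *\<^sub>C x + b *\<^sub>C x"
    and scaleC_scaleC: "a *\<^sub>C b *\<^sub>C x = (a * b) *\<^sub>C x"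
    and scaleC_one: "1 *\<^sub>C x = x"

class star_algebra = complex_vector + ring +
  fixes adj :: "'a \<Rightarrow> 'a"
  assumes mult_scaleC_left: "(c *\<^sub>C x) * y = c *\<^sub>C (x * y)"
    and mult_scaleC_right: "x * (c *\<^sub>C y) = c *\<^sub>C (x * y)"
    and adj_adj: "adj (adj x) = x"
    and adj_add: "adj (x + y) = adj x + adj y"
    and adj_scaleC: "adj (c *\<^sub>C x) = cnj c *\<^sub>C adj x"
    and adj_mult: "adj (x * y) = adj y * adj x"

class complex_normed_vector = complex_vector + real_normed_vector +
  assumes scaleR_scaleC: "r *\<^sub>R x = complex_of_real r *\<^sub>C x"
    and norm_scaleC: "norm (c *\<^sub>C x) = cmod c * norm x"

text \<open>The unit is nonzero here (as in \<^class>\<open>ring_1\<close>); the zero algebra has no nonzero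
  representation, so it is never primitive.\<close>

class unital_cstar_algebra =
  star_algebra + complex_normed_vector + real_normed_algebra_1 + complete_space +
  assumes norm_adj_mult_self: "norm (adj x * x) = (norm x)\<^sup>2"

text \<open>The inner product is linear in the first argument.\<close>

class complex_hilbert_space = complex_normed_vector + complete_space +
  fixes cinner :: "'a \<Rightarrow> 'a \<Rightarrow> complex"
  assumes cinner_add_left: "cinner (x + y) z = cinner x z + cinner y z"
    and cinner_scaleC_left: "cinner (c *\<^sub>C x) y = c * cinner x y"
    and cinner_commute: "cinner y x = cnj (cinner x y)"
    and cinner_self: "cinner x x = complex_of_real ((norm x)\<^sup>2)"

definition star_representation ::
    "('a::unital_cstar_algebra \<Rightarrow> 'h::complex_hilbert_space \<Rightarrow> 'h) \<Rightarrow> bool" where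
  "star_representation \<pi> \<longleftrightarrow>
     (\<forall>a. bounded_linear (\<pi> a) \<and> (\<forall>c v. \<pi> a (c *\<^sub>C v) = c *\<^sub>C \<pi> a v)) \<and>
     (\<forall>a b v. \<pi> (a + b) v = \<pi> a v + \<pi> b v) \<and>
     (\<forall>c a v. \<pi> (c *\<^sub>C a) v = c *\<^sub>C \<pi> a v) \<and>
     (\<forall>a b v. \<pi> (a * b) v = \<pi> a (\<pi> b v)) \<and>
     (\<forall>a v w. cinner (\<pi> (adj a) v) w = cinner v (\<pi> a w))"

definition closed_csubspace :: "'h::complex_normed_vector set \<Rightarrow> bool" where
  "closed_csubspace S \<longleftrightarrow> closed S \<and> 0 \<in> S \<and>
     (\<forall>v\<in>S. \<forall>w\<in>S. v + w \<in> S) \<and> (\<forall>c. \<forall>v\<in>S. c *\<^sub>C v \<in> S)"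

definition irreducible_representation ::
    "('a::unital_cstar_algebra \<Rightarrow> 'h::complex_hilbert_space \<Rightarrow> 'h) \<Rightarrow> bool" where
  "irreducible_representation \<pi> \<longleftrightarrow> star_representation \<pi> \<and>
     (\<forall>S. closed_csubspace S \<and> (\<forall>a. \<forall>v\<in>S. \<pi> a v \<in> S) \<longrightarrow> S = {0} \<or> S = UNIV)"

text \<open>\<open>primitive_algebra TYPE('h) TYPE('a)\<close>: the algebra \<open>'a\<close> has a faithful nonzero
  irreducible representation on the Hilbert space \<open>'h\<close>.  HOL cannot quantify existentially over
  types; as a theorem's hypothesis with \<open>'h\<close> a free type variable occurring nowhere else, this
  says that such a representation exists on some Hilbert space.\<close>

definition primitive_algebra ::
    "'h::complex_hilbert_space itself \<Rightarrow> 'a::unital_cstar_algebra itself \<Rightarrow> bool" where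
  "primitive_algebra _ _ \<longleftrightarrow>
     (\<exists>\<pi> :: 'a \<Rightarrow> 'h \<Rightarrow> 'h. irreducible_representation \<pi> \<and> inj \<pi> \<and> (\<exists>a v. \<pi> a v \<noteq> 0))"

definition jordan_prod :: "'a::star_algebra \<Rightarrow> 'a \<Rightarrow> 'a" where
  "jordan_prod a b = (1 / 2) *\<^sub>C (a * b + b * a)"

definition jordan_star_hom :: "('a::star_algebra \<Rightarrow> 'b::star_algebra) \<Rightarrow> bool" where
  "jordan_star_hom J \<longleftrightarrow>
     (\<forall>a b. J (a + b) = J a + J b) \<and>
     (\<forall>c a. J (c *\<^sub>C a) = c *\<^sub>C J a) \<and>
     (\<forall>a b. J (jordan_prod a b) = jordan_prod (J a) (J b)) \<and>
     (\<forall>a. J (adj a) = adj (J a))"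

definition jordan_star_iso :: "('a::star_algebra \<Rightarrow> 'b::star_algebra) \<Rightarrow> bool" where
  "jordan_star_iso J \<longleftrightarrow> jordan_star_hom J \<and> bij J"

definition sot_continuous ::
    "('y::topological_space \<Rightarrow> 'a \<Rightarrow> 'b::real_normed_vector) \<Rightarrow> bool" where
  "sot_continuous V \<longleftrightarrow> (\<forall>a. continuous_on UNIV (\<lambda>y. V y a))"

text \<open>\<open>'x \<Rightarrow>\<^sub>C 'a\<close> is the type of bounded continuous functions with the supremum norm.  When the
  space \<open>'x\<close> is compact, boundedness is automatic:\<close>

lemma range_apply_bcontfun_compact:
  assumes "compact (UNIV :: 'x::topological_space set)"
  shows "range (apply_bcontfun :: ('x \<Rightarrow>\<^sub>C 'a::metric_space) \<Rightarrow> 'x \<Rightarrow> 'a) =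
    {f. continuous_on UNIV f}"
proof -
  have "f \<in> bcontfun" if "continuous_on UNIV f" for f :: "'x \<Rightarrow> 'a"
    using that compact_imp_bounded[OF compact_continuous_image[OF that assms]]
    by (simp add: bcontfun_def)
  then show ?thesis
    by auto (metis bcontfunE rangeI)
qed

lemma bounded_linear_scaleC: "bounded_linear (\<lambda>x::'a::complex_normed_vector. c *\<^sub>C x)"
  by (rule bounded_linear_intro[where K = "cmod c"])
    (simp_all add: scaleC_add_right scaleR_scaleC scaleC_scaleC norm_scaleC mult.commute)

lemma norm_adj: "norm (adj x) = norm (x::'a::unital_cstar_algebra)"
proof -
  have le: "norm y \<le> norm (adj y)" for y :: 'a
  proof (cases "y = 0")
    case False
    have "norm y * norm y \<le> norm (adj y) * norm y"
      using norm_adj_mult_self[of y] norm_mult_ineq[of "adj y" y]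
      by (simp add: power2_eq_square)
    then show ?thesis using False by simp
  qed simp
  show ?thesis using le[of x] le[of "adj x"] by (simp add: adj_adj)
qed

lemma bounded_linear_adj: "bounded_linear (adj :: 'a::unital_cstar_algebra \<Rightarrow> 'a)"
  by (rule bounded_linear_intro[where K = 1])
    (simp_all add: adj_add scaleR_scaleC adj_scaleC norm_adj)

setup_lifting type_definition_bcontfun

instance bcontfun :: (topological_space, complete_space) complete_space
proof
  fix f :: "nat \<Rightarrow> 'a \<Rightarrow>\<^sub>C 'b"
  assume "Cauchy f"
  then obtain g where "uniform_limit UNIV f g sequentially"
    using uniformly_convergent_eq_cauchy[of "\<lambda>_. True" f]
    unfolding Cauchy_def uniform_limit_sequentially_iff
    by (metis dist_fun_lt_imp_dist_val_lt)
  from uniform_limit_bcontfunE[OF this sequentially_bot] show "convergent f"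
    by (metis convergentI)
qed

instantiation bcontfun :: (topological_space, unital_cstar_algebra) unital_cstar_algebra
begin

lift_definition scaleC_bcontfun :: "complex \<Rightarrow> ('a \<Rightarrow>\<^sub>C 'b) \<Rightarrow> 'a \<Rightarrow>\<^sub>C 'b" is "\<lambda>c f x. c *\<^sub>C f x"
  by (auto simp: bcontfun_def image_image[symmetric]
      intro: bounded_linear.continuous_on[OF bounded_linear_scaleC]
        bounded_linear_image[OF _ bounded_linear_scaleC])

lift_definition times_bcontfun :: "('a \<Rightarrow>\<^sub>C 'b) \<Rightarrow> ('a \<Rightarrow>\<^sub>C 'b) \<Rightarrow> 'a \<Rightarrow>\<^sub>C 'b" is "\<lambda>f g x. f x * g x"
proof -
  fix f g :: "'a \<Rightarrow> 'b"
  assume f: "f \<in> bcontfun" and g: "g \<in> bcontfun"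
  obtain B where B: "norm (f x) \<le> B" for x
    using f by (auto simp: bcontfun_def bounded_iff)
  obtain C where C: "norm (g x) \<le> C" for x
    using g by (auto simp: bcontfun_def bounded_iff)
  have "norm (f x * g x) \<le> B * C" for x
    using norm_mult_ineq[of "f x" "g x"] mult_mono[OF B C] norm_ge_zero[of "f x"] B[of x]
    by (smt (verit) norm_ge_zero)
  then show "(\<lambda>x. f x * g x) \<in> bcontfun"
    using f g by (intro bcontfun_normI) (auto simp: bcontfun_def intro: continuous_on_mult)
qed

lift_definition one_bcontfun :: "'a \<Rightarrow>\<^sub>C 'b" is "\<lambda>_. 1"
  by (rule const_bcontfun)

lift_definition adj_bcontfun :: "('a \<Rightarrow>\<^sub>C 'b) \<Rightarrow> 'a \<Rightarrow>\<^sub>C 'b" is "\<lambda>f x. adj (f x)"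
  by (auto simp: bcontfun_def image_image[symmetric]
      intro: bounded_linear.continuous_on[OF bounded_linear_adj]
        bounded_linear_image[OF _ bounded_linear_adj])

lemmas bcontfun_rep_eqs =
  scaleC_bcontfun.rep_eq times_bcontfun.rep_eq one_bcontfun.rep_eq adj_bcontfun.rep_eq

instance
proof
  fix f g h :: "'a \<Rightarrow>\<^sub>C 'b" and c d :: complex and r :: real
  show "c *\<^sub>C (f + g) = c *\<^sub>C f + c *\<^sub>C g" "(c + d) *\<^sub>C f = c *\<^sub>C f + d *\<^sub>C f"
    "c *\<^sub>C d *\<^sub>C f = (c * d) *\<^sub>C f" "1 *\<^sub>C f = f"
    "(c *\<^sub>C f) * g = c *\<^sub>C (f * g)" "f * (c *\<^sub>C g) = c *\<^sub>C (f * g)"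
    "adj (adj f) = f" "adj (f + g) = adj f + adj g" "adj (c *\<^sub>C f) = cnj c *\<^sub>C adj f"
    "adj (f * g) = adj g * adj f" "r *\<^sub>R f = complex_of_real r *\<^sub>C f"
    "r *\<^sub>R f * g = r *\<^sub>R (f * g)" "f * r *\<^sub>R g = r *\<^sub>R (f * g)"
    "f * g * h = f * (g * h)" "(f + g) * h = f * h + g * h" "f * (g + h) = f * g + f * h"
    "1 * f = f" "f * 1 = f"
    by (auto intro!: bcontfun_eqI
        simp: bcontfun_rep_eqs scaleC_add_right scaleC_add_left scaleC_scaleC scaleC_one
          mult_scaleC_left mult_scaleC_right adj_adj adj_add adj_scaleC adj_mult scaleR_scaleC
          algebra_simps)
  show "(0 :: 'a \<Rightarrow>\<^sub>C 'b) \<noteq> 1"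
  proof
    assume "(0 :: 'a \<Rightarrow>\<^sub>C 'b) = 1"
    then have "apply_bcontfun (0 :: 'a \<Rightarrow>\<^sub>C 'b) undefined = apply_bcontfun 1 undefined"
      by simp
    then show False by (simp add: bcontfun_rep_eqs)
  qed
  show "norm (1 :: 'a \<Rightarrow>\<^sub>C 'b) = 1"
  proof (rule antisym)
    show "norm (1 :: 'a \<Rightarrow>\<^sub>C 'b) \<le> 1"
      by (rule norm_bound) (simp add: bcontfun_rep_eqs)
    show "1 \<le> norm (1 :: 'a \<Rightarrow>\<^sub>C 'b)"
      using norm_bounded[of "1 :: 'a \<Rightarrow>\<^sub>C 'b"] by (simp add: bcontfun_rep_eqs)
  qed
  show mult: "norm (f * g) \<le> norm f * norm g" for f g :: "'a \<Rightarrow>\<^sub>C 'b"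
    by (rule norm_bound)
      (auto simp: bcontfun_rep_eqs
        intro!: order.trans[OF norm_mult_ineq] mult_mono norm_bounded)
  have scale: "norm (c *\<^sub>C f) \<le> cmod c * norm f" for c and f :: "'a \<Rightarrow>\<^sub>C 'b"
    by (rule norm_bound)
      (auto simp: bcontfun_rep_eqs norm_scaleC intro!: mult_left_mono norm_bounded)
  show "norm (c *\<^sub>C f) = cmod c * norm f"
  proof (cases "c = 0")
    case False
    have "f = inverse c *\<^sub>C c *\<^sub>C f"
      using False by (auto intro!: bcontfun_eqI simp: bcontfun_rep_eqs scaleC_scaleC scaleC_one)
    then have "norm f \<le> cmod (inverse c) * norm (c *\<^sub>C f)"
      using scale[of "inverse c" "c *\<^sub>C f"] by simp
    then have "cmod c * norm f \<le> cmod c * (cmod (inverse c) * norm (c *\<^sub>C f))"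
      by (rule mult_left_mono) simp
    also have "\<dots> = norm (c *\<^sub>C f)"
      using False by (simp add: norm_inverse)
    finally have "cmod c * norm f \<le> norm (c *\<^sub>C f)" .
    then show ?thesis using scale[of c f] by simp
  qed (use scale[of c f] in simp)
  have "norm (adj f) \<le> norm f"
    by (rule norm_bound) (simp add: bcontfun_rep_eqs norm_adj norm_bounded)
  then have "norm (adj f * f) \<le> (norm f)\<^sup>2"
    using mult[of "adj f" f] mult_right_mono[of "norm (adj f)" "norm f" "norm f"]
    by (simp add: power2_eq_square)
  moreover have "norm f \<le> sqrt (norm (adj f * f))"
  proof (rule norm_bound)
    fix x
    have "(norm (apply_bcontfun f x))\<^sup>2 \<le> norm (adj f * f)"
      using norm_bounded[of "adj f * f" x] by (simp add: bcontfun_rep_eqs norm_adj_mult_self)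
    then show "norm (apply_bcontfun f x) \<le> sqrt (norm (adj f * f))"
      by (rule real_le_rsqrt)
  qed
  then have "(norm f)\<^sup>2 \<le> norm (adj f * f)"
    by (metis norm_ge_zero power_mono real_sqrt_pow2)
  ultimately show "norm (adj f * f) = (norm f)\<^sup>2"
    by (rule antisym)
qed

end

end

theory Submission
  imports Defs
begin

text \<open>A primitive algebra is prime, and a self-adjoint central element \<open>z\<close> of a prime
  C*-algebra is a real scalar: \<open>(|z| - z) (|z| + z) = 0\<close> forces \<open>z = |z|\<close> or
  \<open>z = - |z|\<close>, so every \<open>z - t\<close> has a sign, and by connectedness some \<open>z - t\<close> has both signs.
  A Jordan *-isomorphism \<open>J\<close> maps the center onto the center and satisfies \<open>J (z F) = J z J F\<close> for
  central \<open>z\<close>. Hence for each \<open>y\<close> the map \<open>f \<mapsto> J (f 1) y\<close> is a character of the real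
  continuous functions, that is, evaluation at a point \<open>\<phi> y\<close>. If \<open>F (\<phi> y) = 0\<close>, then writing
  \<open>F\<close> as \<open>sqrt (norm F)\<close> times a continuous function gives \<open>J F y = 0\<close>, so \<open>J F y\<close> depends only
  on \<open>F (\<phi> y)\<close>. For the converse, continuity of the preimage of a function under \<open>J\<close> needs a bound
  on Jordan *-isomorphisms that is uniform: they preserve unitaries, and a self-adjoint
  contraction is the real part of a unitary.\<close>


section \<open>Elementary rules for complex scalars and the adjoint\<close>

lemma scaleC_zero_right: "c *\<^sub>C (0::'a::complex_vector) = 0"
  using scaleC_add_right[of c 0 0] by simp

lemma scaleC_minus_right: "c *\<^sub>C (- x) = - (c *\<^sub>C (x::'a::complex_vector))"
  using scaleC_add_right[of c x "- x"] by (simp add: scaleC_zero_right eq_neg_iff_add_eq_0 add.commute)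

lemma scaleC_diff_right: "c *\<^sub>C (x - y) = c *\<^sub>C x - c *\<^sub>C (y::'a::complex_vector)"
  using scaleC_add_right[of c x "- y"] by (simp add: scaleC_minus_right)

lemma scaleC_zero_left: "0 *\<^sub>C (x::'a::complex_vector) = 0"
  using scaleC_add_left[of 0 0 x] by simp

lemma scaleC_minus_left: "(- c) *\<^sub>C x = - (c *\<^sub>C (x::'a::complex_vector))"
  using scaleC_add_left[of c "- c" x] by (simp add: scaleC_zero_left eq_neg_iff_add_eq_0 add.commute)

lemma adj_zero: "adj (0::'a::star_algebra) = 0"
  using adj_add[of "0::'a" 0] by simp

lemma adj_minus: "adj (- x) = - adj (x::'a::star_algebra)"
  using adj_add[of x "- x"] by (simp add: adj_zero eq_neg_iff_add_eq_0 add.commute)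

lemma adj_diff: "adj (x - y) = adj x - adj (y::'a::star_algebra)"
  using adj_add[of x "- y"] by (simp add: adj_minus)

lemma adj_one: "adj (1::'a::unital_cstar_algebra) = 1"
  by (metis adj_adj adj_mult mult_1_left mult_1_right)

lemma adj_scaleR: "adj (r *\<^sub>R x) = r *\<^sub>R adj (x::'a::unital_cstar_algebra)"
  by (simp add: scaleR_scaleC adj_scaleC)

lemma double_cancel: "x + x = y + y \<Longrightarrow> x = (y::'a::real_vector)"
  by (metis scaleR_half_double)

lemma adj_mult_self_eq_zero: "adj x * x = 0 \<longleftrightarrow> x = (0::'a::unital_cstar_algebra)"
  using norm_adj_mult_self[of x] by auto

lemma selfadjoint_square_eq_zero:
  "adj x = x \<Longrightarrow> x * x = 0 \<Longrightarrow> x = (0::'a::unital_cstar_algebra)"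
  using adj_mult_self_eq_zero[of x] by simp

subsection \<open>Square roots and unitaries\<close>

text \<open>A fixed point \<open>y = (1/2) *\<^sub>R (x + y * y)\<close> satisfies
  \<open>(1 - y) * (1 - y) = 1 - x\<close>, so the limit of this iteration yields a square root of
  \<open>1 - x\<close>.\<close>

primrec sqrt_iter :: "'a::real_normed_algebra_1 \<Rightarrow> nat \<Rightarrow> 'a" where
  "sqrt_iter x 0 = 0"
| "sqrt_iter x (Suc n) = (1/2) *\<^sub>R (x + sqrt_iter x n * sqrt_iter x n)"

lemma sqrt_iter_diff:
  "sqrt_iter x (Suc (Suc n)) - sqrt_iter x (Suc n) =
    (1/2) *\<^sub>R (sqrt_iter x (Suc n) * (sqrt_iter x (Suc n) - sqrt_iter x n)
      + (sqrt_iter x (Suc n) - sqrt_iter x n) * sqrt_iter x n)"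
proof -
  have *: "(1/2) *\<^sub>R (x + a * a) - (1/2) *\<^sub>R (x + b * b) = (1/2) *\<^sub>R (a * (a - b) + (a - b) * b)"
    for a b :: 'a
    unfolding scaleR_diff_right[symmetric] by (simp add: algebra_simps)
  show ?thesis
    using *[of "sqrt_iter x (Suc n)" "sqrt_iter x n"] by simp
qed

lemma sqrt_iter_one_bounds: "0 \<le> sqrt_iter (1::real) n \<and> sqrt_iter (1::real) n \<le> 1"
proof (induction n)
  case (Suc n)
  then have "sqrt_iter (1::real) n * sqrt_iter 1 n \<le> 1"
    by (simp add: mult_le_one)
  with Suc show ?case by simp
qed simp

lemma norm_sqrt_iter_le:
  assumes "norm x \<le> 1"
  shows "norm (sqrt_iter x n) \<le> sqrt_iter 1 n"
proof (induction n)
  case (Suc n)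
  have "norm (sqrt_iter x n * sqrt_iter x n) \<le> sqrt_iter 1 n * sqrt_iter 1 n"
    by (rule order.trans[OF norm_mult_ineq]) (intro mult_mono Suc, use sqrt_iter_one_bounds in auto)
  with assms norm_triangle_ineq[of x "sqrt_iter x n * sqrt_iter x n"] show ?case
    by simp
qed simp

text \<open>By \<open>sqrt_iter_diff\<close> each increment is built from the previous increment and
  two iterates with positive coefficients, so the triangle inequality lets the scalar iteration for
  \<open>1\<close> dominate it.\<close>

lemma norm_sqrt_iter_step:
  assumes "norm x \<le> 1"
  shows "norm (sqrt_iter x (Suc n) - sqrt_iter x n) \<le> sqrt_iter 1 (Suc n) - sqrt_iter 1 n"
proof (induction n)
  case 0
  then show ?case using assms by simp
next
  case (Suc n)
  let ?y = "sqrt_iter x" and ?r = "sqrt_iter (1::real)"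
  let ?d = "?y (Suc n) - ?y n" and ?e = "?r (Suc n) - ?r n"
  have "norm (?y (Suc n) * ?d + ?d * ?y n) \<le> norm (?y (Suc n)) * norm ?d + norm ?d * norm (?y n)"
    by (intro order.trans[OF norm_triangle_ineq] add_mono norm_mult_ineq)
  also have "\<dots> \<le> ?r (Suc n) * ?e + ?e * ?r n"
    by (intro add_mono mult_mono norm_sqrt_iter_le[OF assms] Suc sqrt_iter_one_bounds[THEN conjunct1]
        norm_ge_zero order.trans[OF norm_ge_zero Suc])
  finally show ?case
    unfolding sqrt_iter_diff by simp
qed

lemma norm_sqrt_iter_diff:
  assumes "norm x \<le> 1" "m \<le> n"
  shows "norm (sqrt_iter x n - sqrt_iter x m) \<le> sqrt_iter 1 n - sqrt_iter 1 m"
  using assms(2)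
proof (induction rule: dec_induct)
  case (step n)
  have "sqrt_iter x (Suc n) - sqrt_iter x m =
      (sqrt_iter x (Suc n) - sqrt_iter x n) + (sqrt_iter x n - sqrt_iter x m)"
    by simp
  also have "norm \<dots> \<le> (sqrt_iter 1 (Suc n) - sqrt_iter 1 n) + (sqrt_iter 1 n - sqrt_iter 1 m)"
    by (intro order.trans[OF norm_triangle_ineq] add_mono norm_sqrt_iter_step assms step.IH)
  finally show ?case by simp
qed simp

text \<open>The iterates are dominated by those for the scalar \<open>1\<close>, which increase to \<open>1\<close>; hence
  they converge even in the boundary case \<open>norm x = 1\<close>.\<close>

lemma Cauchy_sqrt_iter:
  assumes "norm x \<le> 1"
  shows "Cauchy (sqrt_iter x)"
proof (rule CauchyI)
  fix e :: real assume "e > 0"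
  have "incseq (sqrt_iter (1::real))"
    using order.trans[OF norm_ge_zero norm_sqrt_iter_step[of "1::real"]]
    by (intro incseq_SucI) simp
  then obtain L where "sqrt_iter (1::real) \<longlonglongrightarrow> L"
    using sqrt_iter_one_bounds by (elim incseq_convergent[where B = 1]) simp_all
  then have "Cauchy (sqrt_iter (1::real))"
    by (rule LIMSEQ_imp_Cauchy)
  then obtain M where M: "norm (sqrt_iter (1::real) m - sqrt_iter 1 n) < e" if "m \<ge> M" "n \<ge> M" for m n
    using CauchyD \<open>e > 0\<close> by blast
  have "norm (sqrt_iter x n - sqrt_iter x m) < e" if "m \<ge> M" "n \<ge> M" for m n
  proof (cases "m \<le> n")
    case True
    then show ?thesis using norm_sqrt_iter_diff[OF assms True] M[OF that] by auto
  next
    case False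
    then show ?thesis using norm_sqrt_iter_diff[OF assms, of n m] M[OF that]
      by (simp add: norm_minus_commute)
  qed
  then show "\<exists>M. \<forall>m\<ge>M. \<forall>n\<ge>M. norm (sqrt_iter x m - sqrt_iter x n) < e"
    by blast
qed

text \<open>The root is \<open>1 - y\<close> for the limit \<open>y\<close> of the iterates.
  Self-adjointness, norm at most \<open>1\<close> and commutation with everything that commutes with
  \<open>x\<close> hold along the iteration and survive the limit. The bound on \<open>1 - s\<close>
  records that \<open>s\<close> is positive.\<close>

lemma selfadjoint_sqrt:
  fixes x :: "'a::unital_cstar_algebra"
  assumes "adj x = x" "norm x \<le> 1"
  obtains s where "adj s = s" "s * s = 1 - x" "norm (1 - s) \<le> 1"
    "\<And>b. b * x = x * b \<Longrightarrow> b * s = s * b"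
proof -
  let ?y = "sqrt_iter x"
  obtain y where lim: "?y \<longlonglongrightarrow> y"
    using Cauchy_sqrt_iter[OF assms(2)] Cauchy_convergent_iff convergent_def by metis
  have "(\<lambda>n. ?y (Suc n)) \<longlonglongrightarrow> (1/2) *\<^sub>R (x + y * y)"
    unfolding sqrt_iter.simps by (intro tendsto_intros lim)
  then have fix_eq: "y = (1/2) *\<^sub>R (x + y * y)"
    using LIMSEQ_Suc[OF lim] LIMSEQ_unique by blast
  have "adj (?y n) = ?y n" for n
    by (induction n) (simp_all add: adj_zero adj_scaleR adj_add adj_mult assms)
  then have "?y \<longlonglongrightarrow> adj y"
    using bounded_linear.tendsto[OF bounded_linear_adj lim] by simp
  then have adj: "adj y = y" using lim LIMSEQ_unique by blast
  have "norm (?y n) \<le> 1" for n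
    using norm_sqrt_iter_le[OF assms(2), of n] sqrt_iter_one_bounds[of n] by linarith
  then have norm: "norm y \<le> 1"
    by (intro LIMSEQ_le_const2[OF tendsto_norm[OF lim]]) auto
  have comm: "b * y = y * b" if b: "b * x = x * b" for b
  proof -
    have "b * ?y n = ?y n * b" for n
    proof (induction n)
      case (Suc n)
      then have "b * (?y n * ?y n) = (?y n * ?y n) * b"
        by (metis mult.assoc)
      then show ?case using b by (simp add: distrib_left distrib_right)
    qed simp
    then have "(\<lambda>n. b * ?y n) \<longlonglongrightarrow> y * b"
      by (simp add: tendsto_mult lim)
    moreover have "(\<lambda>n. b * ?y n) \<longlonglongrightarrow> b * y"
      by (intro tendsto_intros lim)
    ultimately show ?thesis using LIMSEQ_unique by blast
  qed
  show thesis
  proof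
    show "adj (1 - y) = 1 - y" by (simp add: adj_diff adj_one adj)
    have "y + y = x + y * y"
      using fix_eq by (metis scaleR_half_double scaleR_right_distrib)
    then show "(1 - y) * (1 - y) = 1 - x"
      by (simp add: algebra_simps)
    show "norm (1 - (1 - y)) \<le> 1" using norm by simp
    show "b * (1 - y) = (1 - y) * b" if "b * x = x * b" for b
      using comm[OF that] by (simp add: algebra_simps)
  qed
qed

lemma norm_unitary:
  fixes u :: "'a::unital_cstar_algebra"
  assumes "adj u * u = 1"
  shows "norm u = 1"
  using norm_adj_mult_self[of u] assms by (simp add: power2_eq_1_iff) (smt (verit) norm_ge_zero)

lemma adj_add_ii:
  "adj a = a \<Longrightarrow> adj s = s \<Longrightarrow> adj (a + \<i> *\<^sub>C s) = a - \<i> *\<^sub>C (s::'a::star_algebra)"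
  by (simp add: adj_add adj_scaleC scaleC_minus_left)

lemma mult_add_ii_conj:
  fixes a s :: "'a::star_algebra"
  assumes "a * s = s * a"
  shows "(a - \<i> *\<^sub>C s) * (a + \<i> *\<^sub>C s) = a * a + s * s"
    and "(a + \<i> *\<^sub>C s) * (a - \<i> *\<^sub>C s) = a * a + s * s"
  by (simp_all add: algebra_simps mult_scaleC_left mult_scaleC_right scaleC_scaleC scaleC_minus_left
      scaleC_add_right scaleC_diff_right scaleC_one assms)

text \<open>With \<open>s\<close> a root of \<open>1 - a * a\<close> that commutes with
  \<open>a\<close>, the cross terms in the products of \<open>a + \<i> *\<^sub>C s\<close> and its
  adjoint cancel and leave \<open>a * a + s * s = 1\<close>.\<close>

lemma selfadjoint_unitary_dilation:
  fixes a :: "'a::unital_cstar_algebra"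
  assumes "adj a = a" "norm a \<le> 1"
  obtains s where "adj s = s" "s * s = 1 - a * a" "\<And>b. b * a = a * b \<Longrightarrow> b * s = s * b"
    "adj (a + \<i> *\<^sub>C s) * (a + \<i> *\<^sub>C s) = 1" "(a + \<i> *\<^sub>C s) * adj (a + \<i> *\<^sub>C s) = 1"
proof -
  have "norm (a * a) \<le> 1"
    by (rule order.trans[OF norm_mult_ineq]) (simp add: assms mult_le_one)
  then obtain s where s: "adj s = s" "s * s = 1 - a * a" "\<And>b. b * (a * a) = (a * a) * b \<Longrightarrow> b * s = s * b"
    using selfadjoint_sqrt[of "a * a"] assms(1) by (metis adj_mult)
  have comm: "b * s = s * b" if "b * a = a * b" for b
    using s(3)[of b] that by (metis mult.assoc)
  show thesis
  proof (rule that[OF s(1,2)])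
    show "adj (a + \<i> *\<^sub>C s) * (a + \<i> *\<^sub>C s) = 1" "(a + \<i> *\<^sub>C s) * adj (a + \<i> *\<^sub>C s) = 1"
      unfolding adj_add_ii[OF assms(1) s(1)] mult_add_ii_conj[OF comm[of a, simplified]]
      by (simp_all add: s(2))
  qed (rule comm)
qed

text \<open>Exchanging the two parts of the unitary dilation gives the unitary
  \<open>s + \<i> *\<^sub>C z\<close>. Its real part \<open>s\<close> is a contraction, hence so is
  \<open>s * s = 1 - z * z\<close>.\<close>

lemma norm_one_minus_square_le_one:
  fixes z :: "'a::unital_cstar_algebra"
  assumes "adj z = z" "norm z \<le> 1"
  shows "norm (1 - z * z) \<le> 1"
proof -
  obtain s where s: "adj s = s" "s * s = 1 - z * z" "\<And>b. b * z = z * b \<Longrightarrow> b * s = s * b"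
    using selfadjoint_unitary_dilation[OF assms] by metis
  let ?u = "s + \<i> *\<^sub>C z"
  have "adj ?u * ?u = 1"
    unfolding adj_add_ii[OF s(1) assms(1)] using s(3)[of z] by (subst mult_add_ii_conj) (auto simp: s(2))
  then have u: "norm ?u = 1" by (rule norm_unitary)
  have "s + s = ?u + adj ?u"
    by (simp add: adj_add_ii s assms)
  then have "2 * norm s \<le> 2"
    using norm_triangle_ineq[of ?u "adj ?u"] u norm_adj[of ?u] scaleR_2[of s]
    by (metis norm_scaleR abs_numeral one_add_one)
  then show ?thesis
    unfolding s(2)[symmetric] by (intro order.trans[OF norm_mult_ineq]) (simp add: mult_le_one)
qed

subsection \<open>The center of a prime C*-algebra\<close>

definition central :: "'a::times \<Rightarrow> bool" where
  "central z \<longleftrightarrow> (\<forall>b. z * b = b * z)"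

definition prime_algebra :: "'a::ring itself \<Rightarrow> bool" where
  "prime_algebra _ \<longleftrightarrow> (\<forall>a b :: 'a. (\<forall>c. a * c * b = 0) \<longrightarrow> a = 0 \<or> b = 0)"

lemma prime_algebra_central_mult_eq_zero:
  fixes a b :: "'a::ring"
  assumes "prime_algebra TYPE('a)" "central a" "a * b = 0"
  shows "a = 0 \<or> b = 0"
proof -
  have "a * c * b = 0" for c
    by (metis assms(2,3) central_def mult.assoc mult_zero_right)
  then show ?thesis using assms(1) by (simp add: prime_algebra_def)
qed

text \<open>If \<open>a * c * b = 0\<close> for all \<open>c\<close> and
  \<open>b \<noteq> 0\<close>, the vectors annihilated by all \<open>\<pi> (a * c)\<close> form a
  closed invariant subspace containing some nonzero \<open>\<pi> b v\<close>. Irreducibility makes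
  it the whole space; then \<open>c = 1\<close> and injectivity of \<open>\<pi>\<close> give
  \<open>a = 0\<close>.\<close>

lemma primitive_imp_prime_algebra:
  assumes "primitive_algebra TYPE('h::complex_hilbert_space) TYPE('a::unital_cstar_algebra)"
  shows "prime_algebra TYPE('a)"
proof -
  obtain \<pi> :: "'a \<Rightarrow> 'h \<Rightarrow> 'h" where irr: "irreducible_representation \<pi>" and inj: "inj \<pi>"
      and nz: "\<exists>a v. \<pi> a v \<noteq> 0"
    using assms unfolding primitive_algebra_def by blast
  have bl: "bounded_linear (\<pi> a)" and scale: "\<pi> a (c *\<^sub>C v) = c *\<^sub>C \<pi> a v"
    and add: "\<pi> (a + b) v = \<pi> a v + \<pi> b v"
    and scale': "\<pi> (c *\<^sub>C a) v = c *\<^sub>C \<pi> a v"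
    and mult: "\<pi> (a * b) v = \<pi> a (\<pi> b v)" for a b c v
    using irr unfolding irreducible_representation_def star_representation_def by blast+
  have inv: "S = {0} \<or> S = UNIV" if "closed_csubspace S" "\<And>a v. v \<in> S \<Longrightarrow> \<pi> a v \<in> S" for S
    using irr that unfolding irreducible_representation_def by blast
  note lin [simp] = linear_0[OF bounded_linear.linear[OF bl]] linear_add[OF bounded_linear.linear[OF bl]]
  have zero: "\<pi> 0 v = 0" for v using add[of 0 0 v] by simp
  have cont: "continuous_on UNIV (\<pi> a)" for a
    using bl by (simp add: linear_continuous_on)
  have null: "(\<forall>c. \<pi> (a * c) w = 0) \<longrightarrow> a = 0 \<or> w = 0" for a :: 'a and w :: 'h
  proof (intro impI)
    assume w: "\<forall>c. \<pi> (a * c) w = 0"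
    let ?S = "{v. \<forall>c. \<pi> (a * c) v = 0}"
    have "closed_csubspace ?S"
      unfolding closed_csubspace_def
      by (auto simp: scale scaleC_zero_right intro!: closed_Collect_all closed_Collect_eq cont)
    moreover have "\<pi> b v \<in> ?S" if "v \<in> ?S" for b v
      using that by (simp flip: mult add: mult.assoc)
    ultimately have "?S = {0} \<or> ?S = UNIV" by (rule inv)
    then show "a = 0 \<or> w = 0"
    proof
      assume "?S = {0}"
      with w show ?thesis by blast
    next
      assume "?S = UNIV"
      then have "\<pi> (a * 1) v = 0" for v by blast
      then have "\<pi> a = \<pi> 0" by (intro ext) (simp add: zero)
      with inj show ?thesis by (simp add: inj_eq)
    qed
  qed
  have "a = 0 \<or> b = 0" if "\<forall>c. a * c * b = 0" for a b :: 'a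
  proof (rule disjCI)
    assume "b \<noteq> 0"
    then obtain v where v: "\<pi> b v \<noteq> 0"
      using inj zero by (metis (no_types, lifting) ext injD)
    have "\<pi> (a * c) (\<pi> b v) = 0" for c
      using that by (simp flip: mult add: zero)
    with v null[of a "\<pi> b v"] show "a = 0" by blast
  qed
  then show ?thesis unfolding prime_algebra_def by blast
qed

text \<open>Commutation turns the sum of squares into \<open>adj x * x\<close> for
  \<open>x = k + \<i> *\<^sub>C l\<close>, so \<open>x\<close> vanishes, and with it
  \<open>x + adj x = k + k\<close>.\<close>

lemma selfadjoint_sum_squares_eq_zero:
  fixes k l :: "'a::unital_cstar_algebra"
  assumes "adj k = k" "adj l = l" "k * l = l * k" "k * k + l * l = 0"
  shows "k = 0"
proof -
  have "adj (k + \<i> *\<^sub>C l) * (k + \<i> *\<^sub>C l) = 0"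
    unfolding adj_add_ii[OF assms(1,2)] mult_add_ii_conj[OF assms(3)] by (fact assms(4))
  then have "k + \<i> *\<^sub>C l = 0" by (simp add: adj_mult_self_eq_zero)
  moreover from arg_cong[OF this, of adj] have "k - \<i> *\<^sub>C l = 0"
    unfolding adj_add_ii[OF assms(1,2)] adj_zero .
  ultimately have "k + k = 0 + 0"
    by simp
  then show ?thesis by (rule double_cancel)
qed

text \<open>The inequalities \<open>norm (1 - w) \<le> 1\<close> and \<open>norm (1 + w) \<le> 1\<close> make \<open>w\<close> and \<open>- w\<close>
  squares of self-adjoint elements.\<close>

lemma selfadjoint_nonneg_nonpos_imp_zero:
  fixes w :: "'a::unital_cstar_algebra"
  assumes "adj w = w" "norm (1 - w) \<le> 1" "norm (1 + w) \<le> 1"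
  shows "w = 0"
proof -
  obtain k where k: "adj k = k" "k * k = 1 - (1 - w)" "\<And>b. b * (1 - w) = (1 - w) * b \<Longrightarrow> b * k = k * b"
    using selfadjoint_sqrt[of "1 - w"] assms by (metis adj_diff adj_one)
  obtain l where l: "adj l = l" "l * l = 1 - (1 + w)" "\<And>b. b * (1 + w) = (1 + w) * b \<Longrightarrow> b * l = l * b"
    using selfadjoint_sqrt[of "1 + w"] assms by (metis adj_add adj_one)
  have "w * k = k * w" by (rule k(3)) (simp add: algebra_simps)
  then have "k * l = l * k" by (intro l(3)) (simp add: algebra_simps)
  moreover have "k * k + l * l = 0" by (simp add: k l)
  ultimately have "k = 0" by (intro selfadjoint_sum_squares_eq_zero[OF k(1) l(1)])
  then show ?thesis using k(2) by simp
qed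

text \<open>For a self-adjoint contraction, \<open>norm (1 - z) \<le> 1\<close> encodes that
  \<open>z\<close> is positive and \<open>norm (1 + z) \<le> 1\<close> that it is negative. The
  positive root \<open>t\<close> of \<open>z * z\<close> serves as the absolute value.\<close>

lemma central_selfadjoint_sign:
  fixes z :: "'a::unital_cstar_algebra"
  assumes "prime_algebra TYPE('a)" "central z" "adj z = z" "norm z \<le> 1"
  shows "norm (1 - z) \<le> 1 \<or> norm (1 + z) \<le> 1"
proof -
  have "adj (1 - z * z) = 1 - z * z"
    by (simp add: adj_diff adj_one adj_mult assms)
  then obtain t where t: "t * t = 1 - (1 - z * z)" "norm (1 - t) \<le> 1"
      "\<And>b. b * (1 - z * z) = (1 - z * z) * b \<Longrightarrow> b * t = t * b"
    using selfadjoint_sqrt[of "1 - z * z"] norm_one_minus_square_le_one[OF assms(3,4)] by metis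
  have zb: "z * b = b * z" for b
    using assms(2) by (simp add: central_def)
  have zz: "b * (z * z) = (z * z) * b" for b
    by (metis mult.assoc zb)
  have "b * t = t * b" for b
    by (rule t(3)) (simp add: algebra_simps zz)
  then have "central (t - z)"
    unfolding central_def by (simp add: algebra_simps zb)
  moreover have "(t - z) * (t + z) = 0"
    by (simp add: distrib_left left_diff_distrib t(1) zb[of t])
  ultimately have "t - z = 0 \<or> t + z = 0"
    by (rule prime_algebra_central_mult_eq_zero[OF assms(1)])
  with t(2) show ?thesis by (auto simp: eq_neg_iff_add_eq_0[symmetric])
qed

lemma central_selfadjoint_scalar_small:
  fixes z :: "'a::unital_cstar_algebra"
  assumes "prime_algebra TYPE('a)" "central z" "adj z = z" "norm z \<le> 1/2"
  shows "\<exists>r::real. z = r *\<^sub>R 1"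
proof -
  define w where "w = (\<lambda>t::real. z - t *\<^sub>R 1)"
  \<comment> \<open>The radius \<open>1/2\<close> keeps every \<open>w t\<close> in the unit ball,
    so that it has a sign, and makes \<open>w\<close> positive at the left end and negative at the
    right end.\<close>
  let ?I = "{-1/2..1/2::real}"
  have cont: "continuous_on UNIV w" unfolding w_def by (intro continuous_intros)
  have "closed {t. norm (1 - w t) \<le> 1}" "closed {t. norm (1 + w t) \<le> 1}"
    by (intro closed_Collect_le continuous_intros cont)+
  moreover have "?I \<subseteq> {t. norm (1 - w t) \<le> 1} \<union> {t. norm (1 + w t) \<le> 1}"
  proof
    fix t :: real assume t: "t \<in> ?I"
    have "norm (w t) \<le> norm z + norm (t *\<^sub>R (1::'a))"
      unfolding w_def by (rule norm_triangle_ineq4)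
    also have "\<dots> \<le> 1" using t assms(4) by auto
    finally have "norm (w t) \<le> 1" .
    moreover have "central (w t)"
      using assms(2) unfolding central_def w_def by (simp add: algebra_simps)
    moreover have "adj (w t) = w t"
      by (simp add: w_def adj_diff adj_scaleR adj_one assms)
    ultimately show "t \<in> {t. norm (1 - w t) \<le> 1} \<union> {t. norm (1 + w t) \<le> 1}"
      using central_selfadjoint_sign[OF assms(1)] by blast
  qed
  moreover have "connected ?I" by simp
  moreover have "-1/2 \<in> {t. norm (1 - w t) \<le> 1} \<inter> ?I"
  proof -
    have "1 - w (-1/2) = (1/2) *\<^sub>R 1 - z"
      using scaleR_left_distrib[of "1/2" "1/2" "1::'a"] by (simp add: w_def algebra_simps)
    then show ?thesis
      using norm_triangle_ineq4[of "(1/2) *\<^sub>R (1::'a)" z] assms(4) by simp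
  qed
  moreover have "1/2 \<in> {t. norm (1 + w t) \<le> 1} \<inter> ?I"
  proof -
    have "1 + w (1/2) = (1/2) *\<^sub>R 1 + z"
      using scaleR_left_distrib[of "1/2" "1/2" "1::'a"] by (simp add: w_def algebra_simps)
    then show ?thesis
      using norm_triangle_ineq[of "(1/2) *\<^sub>R (1::'a)" z] assms(4) by simp
  qed
  ultimately obtain t where "norm (1 - w t) \<le> 1" "norm (1 + w t) \<le> 1"
    unfolding connected_closed by blast
  then have "w t = 0"
    by (intro selfadjoint_nonneg_nonpos_imp_zero)
      (simp_all add: w_def adj_diff adj_scaleR adj_one assms)
  then show ?thesis by (auto simp: w_def)
qed

lemma central_selfadjoint_scalar:
  fixes z :: "'a::unital_cstar_algebra"
  assumes "prime_algebra TYPE('a)" "central z" "adj z = z"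
  shows "\<exists>r::real. z = r *\<^sub>R 1"
proof (cases "z = 0")
  case False
  let ?c = "1 / (2 * norm z)"
  have "\<exists>r::real. ?c *\<^sub>R z = r *\<^sub>R 1"
    using assms False
    by (intro central_selfadjoint_scalar_small) (simp_all add: central_def adj_scaleR)
  then obtain r where "?c *\<^sub>R z = r *\<^sub>R 1" by blast
  then have "(2 * norm z) *\<^sub>R ?c *\<^sub>R z = (2 * norm z * r) *\<^sub>R 1" by simp
  then have "z = (2 * norm z * r) *\<^sub>R 1" using False by simp
  then show ?thesis by blast
qed (auto intro: exI[of _ 0])


subsection \<open>Jordan *-isomorphisms\<close>

lemma two_jordan_prod: "jordan_prod a b + jordan_prod a b = a * b + b * a"
  by (simp add: jordan_prod_def scaleC_one flip: scaleC_add_left)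

context
  fixes J :: "'a::unital_cstar_algebra \<Rightarrow> 'b::unital_cstar_algebra"
  assumes J: "jordan_star_hom J"
begin

lemma jordan_hom_add: "J (a + b) = J a + J b"
  using J by (simp add: jordan_star_hom_def)

lemma jordan_hom_scaleC: "J (c *\<^sub>C a) = c *\<^sub>C J a"
  using J by (simp add: jordan_star_hom_def)

lemma jordan_hom_adj: "J (adj a) = adj (J a)"
  using J by (simp add: jordan_star_hom_def)

lemma jordan_hom_scaleR: "J (r *\<^sub>R a) = r *\<^sub>R J a"
  by (simp add: scaleR_scaleC jordan_hom_scaleC)

lemma jordan_hom_zero: "J 0 = 0"
  using jordan_hom_add[of 0 0] by simp

lemma jordan_hom_diff: "J (a - b) = J a - J b"
  using jordan_hom_add[of "a - b" b] by simp

lemma jordan_hom_symmetrized: "J (a * b + b * a) = J a * J b + J b * J a"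
proof -
  have "J (jordan_prod a b) = jordan_prod (J a) (J b)"
    using J by (simp add: jordan_star_hom_def)
  then show ?thesis
    unfolding two_jordan_prod[symmetric] jordan_hom_add by simp
qed

lemma jordan_hom_mult_commuting:
  assumes "a * b = b * a" "J a * J b = J b * J a"
  shows "J (a * b) = J a * J b"
proof (rule double_cancel)
  show "J (a * b) + J (a * b) = J a * J b + J a * J b"
    using jordan_hom_symmetrized[of a b] jordan_hom_add[of "a * b" "a * b"]
    unfolding assms[symmetric] by simp
qed

lemma jordan_hom_square: "J (a * a) = J a * J a"
  by (rule jordan_hom_mult_commuting) simp_all

text \<open>Twice \<open>a * b * a\<close> equals \<open>?T a b\<close>, which uses only symmetrized
  products and squares, and these are preserved by \<open>J\<close>.\<close>

lemma jordan_hom_triple: "J (a * b * a) = J a * J b * J a"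
proof (rule double_cancel)
  let ?T = "\<lambda>x y. (x * y + y * x) * x + x * (x * y + y * x) - ((x * x) * y + y * (x * x))"
  have "?T a b = a * b * a + a * b * a" "?T (J a) (J b) = J a * J b * J a + J a * J b * J a"
    by (simp_all add: algebra_simps)
  moreover have "J (?T a b) = ?T (J a) (J b)"
    unfolding jordan_hom_diff jordan_hom_symmetrized jordan_hom_square by (rule refl)
  ultimately show "J (a * b * a) + J (a * b * a) = J a * J b * J a + J a * J b * J a"
    using jordan_hom_add[of "a * b * a" "a * b * a"] by simp
qed

context
  assumes surj: "surj J"
begin

text \<open>For a preimage \<open>e\<close> of \<open>1\<close>, the symmetrized product of
  \<open>1\<close> and \<open>e\<close> is \<open>e + e\<close>; its image is both
  \<open>1 + 1\<close> and \<open>J 1 + J 1\<close>.\<close>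

lemma jordan_hom_one: "J 1 = 1"
proof -
  obtain e where "J e = 1" using surj by (metis surjD)
  with jordan_hom_symmetrized[of 1 e] jordan_hom_add[of e e] have "J 1 + J 1 = 1 + 1" by simp
  then show ?thesis by (rule double_cancel)
qed

text \<open>Unitarity of \<open>u\<close> can be expressed by the Jordan triple products \<open>u u\<^sup>* u = u\<close> and
  \<open>u (u\<^sup>*)\<^sup>2 u = 1\<close>.\<close>

lemma jordan_hom_unitary:
  assumes "adj u * u = 1" "u * adj u = 1"
  shows "adj (J u) * J u = 1"
proof -
  have "J u * (J (adj u) * J (adj u)) * J u = J (u * (adj u * adj u) * u)"
    by (simp add: jordan_hom_triple jordan_hom_square)
  also have "u * (adj u * adj u) * u = 1"
    by (metis assms mult.assoc mult_1_right)
  finally have left: "(J u * (J (adj u) * J (adj u))) * J u = 1"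
    by (simp add: jordan_hom_one)
  have "J u * J (adj u) * J u = J u"
    using jordan_hom_triple[of u "adj u"] assms by (simp add: mult.assoc)
  \<comment> \<open>By \<open>left\<close>, \<open>J u\<close> has a left inverse, which cancels the
    leading factor in \<open>J u * J (adj u) * J u = J u\<close>.\<close>
  then have "(J u * (J (adj u) * J (adj u))) * (J u * (J (adj u) * J u)) = (J u * (J (adj u) * J (adj u))) * J u"
    by (simp add: mult.assoc)
  then have "J (adj u) * J u = 1"
    unfolding mult.assoc[symmetric, of _ "J u"] left by simp
  then show ?thesis by (simp add: jordan_hom_adj)
qed

lemma norm_jordan_hom_selfadjoint_le_one:
  assumes "adj a = a" "norm a \<le> 1"
  shows "norm (J a) \<le> 1"
proof -
  obtain s where s: "adj s = s" and
    u: "adj (a + \<i> *\<^sub>C s) * (a + \<i> *\<^sub>C s) = 1" "(a + \<i> *\<^sub>C s) * adj (a + \<i> *\<^sub>C s) = 1"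
    using selfadjoint_unitary_dilation[OF assms] by metis
  let ?w = "J (a + \<i> *\<^sub>C s)"
  have w: "norm ?w = 1" by (rule norm_unitary) (rule jordan_hom_unitary[OF u])
  have "J a + J a = ?w + adj ?w"
    unfolding jordan_hom_adj[symmetric] adj_add_ii[OF assms(1) s]
    by (simp add: jordan_hom_add jordan_hom_diff)
  then have "2 * norm (J a) \<le> 2"
    using norm_triangle_ineq[of ?w "adj ?w"] w norm_adj[of ?w] scaleR_2[of "J a"]
    by (metis norm_scaleR abs_numeral one_add_one)
  then show ?thesis by simp
qed

lemma norm_jordan_hom_selfadjoint_le:
  assumes "adj a = a"
  shows "norm (J a) \<le> norm a"
proof (cases "a = 0")
  case False
  have "norm (J ((1 / norm a) *\<^sub>R a)) \<le> 1"
    using False assms by (intro norm_jordan_hom_selfadjoint_le_one) (simp_all add: adj_scaleR)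
  with False show ?thesis by (simp add: jordan_hom_scaleR field_simps)
qed (simp add: jordan_hom_zero)

text \<open>The constant \<open>2\<close> comes from bounding the self-adjoint and skew-adjoint
  parts of \<open>a\<close> separately. What matters later is that it does not depend on
  \<open>J\<close>.\<close>

lemma norm_jordan_hom_le: "norm (J a) \<le> 2 * norm a"
proof -
  let ?h = "a + adj a" and ?k = "\<i> *\<^sub>C (a - adj a)"
  have h: "norm (J ?h) \<le> 2 * norm a"
    using norm_jordan_hom_selfadjoint_le[of ?h] norm_triangle_ineq[of a "adj a"]
    by (simp add: adj_add adj_adj norm_adj add.commute)
  have "norm (J ?k) \<le> norm ?k"
    by (rule norm_jordan_hom_selfadjoint_le)
      (simp add: adj_scaleC adj_diff adj_adj scaleC_minus_left scaleC_diff_right)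
  also have "\<dots> \<le> 2 * norm a"
    using norm_triangle_ineq4[of a "adj a"] by (simp add: norm_scaleC norm_adj)
  finally have k: "norm (J (a - adj a)) \<le> 2 * norm a"
    by (simp add: jordan_hom_scaleC norm_scaleC)
  have "2 *\<^sub>R J a = J ?h + J (a - adj a)"
    by (simp add: scaleR_2 jordan_hom_add jordan_hom_diff)
  then have "2 * norm (J a) \<le> norm (J ?h) + norm (J (a - adj a))"
    by (metis norm_triangle_ineq norm_scaleR abs_numeral)
  with h k show ?thesis by simp
qed

text \<open>Multiplication by a central element commutes with Jordan multiplication by any element.
  This makes the commutators of its image central, and a central commutator is nilpotent.\<close>

lemma jordan_hom_central:
  assumes "central z"
  shows "central (J z)"
proof -
  let ?z = "J z"
  have zb: "z * b = b * z" for b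
    using assms by (simp add: central_def)
  have comm: "(?z * b - b * ?z) * c = c * (?z * b - b * ?z)" for b c
  proof -
    obtain b' c' where bc: "b = J b'" "c = J c'" using surj by (metis surjD)
    have "z * (b' * c' + c' * b') + (b' * c' + c' * b') * z
        = b' * (z * c' + c' * z) + (z * c' + c' * z) * b'"
      by (simp add: zb distrib_left distrib_right mult.assoc add_ac)
    then have "J (z * (b' * c' + c' * b') + (b' * c' + c' * b') * z)
        = J (b' * (z * c' + c' * z) + (z * c' + c' * z) * b')" by simp
    then have "?z * (b * c + c * b) + (b * c + c * b) * ?z = b * (?z * c + c * ?z) + (?z * c + c * ?z) * b"
      unfolding jordan_hom_symmetrized bc .
    then show ?thesis by (simp add: algebra_simps)
  qed
  have "?z * b = b * ?z" for b
  proof -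
    define d where "d = ?z * b - b * ?z"
    have d: "d * c = c * d" for c unfolding d_def by (rule comm)
    \<comment> \<open>\<open>d * ?z\<close> is again a commutator with \<open>?z\<close>, hence
      commutes with \<open>b\<close>. Since \<open>d\<close> is central, \<open>d * d\<close> is the
      commutator of \<open>d * ?z\<close> and \<open>b\<close>, so it vanishes; centrality of
      \<open>d\<close> then gives the self-adjoint element \<open>adj d * d\<close> square
      zero.\<close>
    have "d * ?z = ?z * (b * ?z) - (b * ?z) * ?z"
      by (simp add: d_def algebra_simps)
    then have "(d * ?z) * b = b * (d * ?z)"
      using comm[of "b * ?z" b] by simp
    moreover have "d * d = (d * ?z) * b - b * (d * ?z)"
      by (subst (2) d_def) (simp add: right_diff_distrib d[of b] flip: mult.assoc)
    ultimately have "d * d = 0" by simp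
    moreover have "(adj d * d) * (adj d * d) = adj d * (adj d * (d * d))"
      by (simp add: mult.assoc d[of "adj d * d"])
    ultimately have "(adj d * d) * (adj d * d) = 0" by simp
    then have "adj d * d = 0"
      by (rule selfadjoint_square_eq_zero[rotated]) (simp add: adj_mult adj_adj)
    then have "d = 0" by (simp add: adj_mult_self_eq_zero)
    then show ?thesis by (simp add: d_def)
  qed
  then show ?thesis by (simp add: central_def)
qed

lemma jordan_hom_central_mult:
  assumes "central z"
  shows "J (z * a) = J z * J a"
  using assms jordan_hom_central[OF assms] by (intro jordan_hom_mult_commuting) (auto simp: central_def)

end

end

lemma jordan_star_iso_inv:
  fixes J :: "'a::unital_cstar_algebra \<Rightarrow> 'b::unital_cstar_algebra"
  assumes "jordan_star_iso J"
  shows "jordan_star_iso (inv J)"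
proof -
  have J: "jordan_star_hom J" and bij: "bij J"
    using assms by (auto simp: jordan_star_iso_def)
  have inv: "inv J b = a" if "J a = b" for a b
    using bij that by (metis bij_inv_eq_iff)
  have JJ: "J (inv J b) = b" for b
    using bij by (metis bij_inv_eq_iff)
  have "jordan_star_hom (inv J)"
    unfolding jordan_star_hom_def
  proof (intro conjI allI; rule inv)
    fix a b :: 'b and c :: complex
    show "J (inv J a + inv J b) = a + b"
      by (simp add: jordan_hom_add[OF J] JJ)
    show "J (c *\<^sub>C inv J a) = c *\<^sub>C a"
      by (simp add: jordan_hom_scaleC[OF J] JJ)
    show "J (jordan_prod (inv J a) (inv J b)) = jordan_prod a b"
      using J by (simp add: jordan_star_hom_def JJ)
    show "J (adj (inv J a)) = adj a"
      by (simp add: jordan_hom_adj[OF J] JJ)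
  qed
  then show ?thesis
    using bij by (simp add: jordan_star_iso_def bij_imp_bij_inv)
qed

subsection \<open>Algebras of continuous functions\<close>

lemma compact_t2_Urysohn:
  fixes U :: "'x::t2_space set"
  assumes "compact (UNIV :: 'x set)" "open U" "a \<in> U"
  obtains f :: "'x \<Rightarrow> real" where "continuous_on UNIV f" "f a = 1" "\<And>x. x \<notin> U \<Longrightarrow> f x = 0"
proof -
  have "compact_space (euclidean :: 'x topology)"
    using assms(1) by (simp add: compact_space_def)
  moreover have "Hausdorff_space (euclidean :: 'x topology)"
    by (simp add: Hausdorff_space_def disjnt_def) (metis hausdorff)
  ultimately have "completely_regular_space (euclidean :: 'x topology)"
    by (simp add: normal_imp_completely_regular_space compact_Hausdorff_or_regular_imp_normal_space)
  then obtain f where f: "continuous_map euclidean euclideanreal f" "f a = 0" "f ` (UNIV - U) \<subseteq> {1}"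
    using assms(2,3) unfolding completely_regular_space_alt' by force
  \<comment> \<open>The function \<open>f\<close> is \<open>0\<close> at \<open>a\<close> and
    \<open>1\<close> off \<open>U\<close>, hence the reflection \<open>1 - f\<close>.\<close>
  show thesis
  proof (rule that[of "\<lambda>x. 1 - f x"])
    show "continuous_on UNIV (\<lambda>x. 1 - f x)"
      using f(1) by (intro continuous_intros) simp
  qed (use f in auto)
qed

lemma apply_Bcontfun_compact:
  fixes f :: "'x::topological_space \<Rightarrow> 'a::metric_space"
  assumes "compact (UNIV :: 'x set)" "continuous_on UNIV f"
  shows "apply_bcontfun (Bcontfun f) = f"
  using range_apply_bcontfun_compact[OF assms(1), where 'a = 'a] assms(2)
  by (metis apply_bcontfun_inverse imageE mem_Collect_eq)

text \<open>\<open>Bcontfun\<close> represents its argument faithfully only when that is bounded and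
  continuous; hence the compactness and continuity assumptions in the lemmas evaluating this
  embedding.\<close>

definition scalar_fun :: "('x::topological_space \<Rightarrow> real) \<Rightarrow> 'x \<Rightarrow>\<^sub>C 'a::unital_cstar_algebra" where
  "scalar_fun f = Bcontfun (\<lambda>x. f x *\<^sub>R 1)"

lemma apply_scalar_fun:
  fixes f :: "'x::topological_space \<Rightarrow> real"
  assumes "compact (UNIV :: 'x set)" "continuous_on UNIV f"
  shows "apply_bcontfun (scalar_fun f) x = f x *\<^sub>R 1"
  unfolding scalar_fun_def using assms by (subst apply_Bcontfun_compact) (auto intro!: continuous_intros)

lemma central_apply_bcontfun:
  fixes F :: "'x::topological_space \<Rightarrow>\<^sub>C 'a::unital_cstar_algebra"
  assumes "central F"
  shows "central (apply_bcontfun F x)"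
  unfolding central_def
proof
  fix b
  have "apply_bcontfun (F * const_bcontfun b) x = apply_bcontfun (const_bcontfun b * F) x"
    using assms by (simp add: central_def)
  then show "apply_bcontfun F x * b = b * apply_bcontfun F x"
    by (simp add: bcontfun_rep_eqs const_bcontfun.rep_eq)
qed

lemma apply_jordan_prod:
  "apply_bcontfun (jordan_prod F G) x = jordan_prod (apply_bcontfun F x) (apply_bcontfun G x)"
  by (simp add: jordan_prod_def bcontfun_rep_eqs plus_bcontfun.rep_eq)

text \<open>Dividing by the square root of the norm leaves a quotient whose norm is that same square
  root, so it tends to \<open>0\<close> at the zeros of \<open>F\<close>. There
  \<open>inverse 0 = 0\<close> supplies the matching value.\<close>

lemma scalar_fun_divide_sqrt_norm:
  fixes F :: "'x::t2_space \<Rightarrow>\<^sub>C 'a::unital_cstar_algebra"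
  assumes "compact (UNIV :: 'x set)"
  obtains G where "F = scalar_fun (\<lambda>x. sqrt (norm (apply_bcontfun F x))) * G"
proof -
  let ?g = "\<lambda>x. sqrt (norm (apply_bcontfun F x))"
  let ?G = "\<lambda>x. inverse (?g x) *\<^sub>R apply_bcontfun F x"
  have g: "continuous_on UNIV ?g" by (intro continuous_intros) simp
  have F: "isCont (apply_bcontfun F) x" for x
    by (metis UNIV_I continuous_on_apply_bcontfun continuous_on_eq_continuous_at open_UNIV)
  have norm_G: "norm (?G x) = ?g x" for x
    by (cases "apply_bcontfun F x = 0") (simp_all add: field_simps)
  have "isCont ?G x" for x
  proof (cases "apply_bcontfun F x = 0")
    case True
    have "isCont ?g x"
      using g by (simp add: continuous_on_eq_continuous_at)
    then have "(?g \<longlongrightarrow> 0) (at x)"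
      by (simp add: isCont_def True)
    then have "(?G \<longlongrightarrow> 0) (at x)"
      by (intro tendsto_norm_zero_cancel[of ?G]) (simp only: norm_G)
    then show ?thesis by (simp add: isCont_def True)
  next
    case False
    then show ?thesis by (intro continuous_intros F) simp
  qed
  then have G: "continuous_on UNIV ?G"
    by (simp add: continuous_on_eq_continuous_at)
  have "F = scalar_fun ?g * Bcontfun ?G"
  proof (rule bcontfun_eqI)
    fix x
    show "apply_bcontfun F x = apply_bcontfun (scalar_fun ?g * Bcontfun ?G) x"
      unfolding bcontfun_rep_eqs apply_scalar_fun[OF assms g] apply_Bcontfun_compact[OF assms G]
      by (cases "apply_bcontfun F x = 0") simp_all
  qed
  then show thesis by (rule that)
qed

section \<open>Evaluation points of a surjective Jordan *-homomorphism\<close>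

context
  fixes J :: "('x::t2_space \<Rightarrow>\<^sub>C 'a::unital_cstar_algebra) \<Rightarrow>
    ('y::topological_space \<Rightarrow>\<^sub>C 'b::unital_cstar_algebra)"
  assumes cX: "compact (UNIV :: 'x set)"
    and prime: "prime_algebra TYPE('b)"
    and J: "jordan_star_hom J" and surj: "surj J"
begin

private abbreviation S :: "('x \<Rightarrow> real) \<Rightarrow> 'x \<Rightarrow>\<^sub>C 'a" where
  "S \<equiv> scalar_fun"

lemma central_scalar_fun: "continuous_on UNIV f \<Longrightarrow> central (S f)"
  unfolding central_def
  by (auto intro!: bcontfun_eqI simp: bcontfun_rep_eqs apply_scalar_fun[OF cX])

lemma jordan_hom_scalar_fun:
  assumes "continuous_on UNIV f"
  obtains r where "apply_bcontfun (J (S f)) y = r *\<^sub>R 1"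
proof -
  have "central (J (S f))"
    by (rule jordan_hom_central[OF J surj central_scalar_fun[OF assms]])
  moreover have "adj (S f) = S f"
    using assms by (auto intro!: bcontfun_eqI simp: bcontfun_rep_eqs apply_scalar_fun[OF cX] adj_scaleR adj_one)
  then have "adj (apply_bcontfun (J (S f)) y) = apply_bcontfun (J (S f)) y"
    using jordan_hom_adj[OF J, of "S f"] by (metis adj_bcontfun.rep_eq)
  ultimately have "\<exists>r::real. apply_bcontfun (J (S f)) y = r *\<^sub>R 1"
    using central_selfadjoint_scalar[OF prime] central_apply_bcontfun by blast
  then show thesis using that by blast
qed

lemma jordan_hom_scalar_fun_mult:
  assumes "continuous_on UNIV f"
  shows "apply_bcontfun (J (S f * F)) y = apply_bcontfun (J (S f)) y * apply_bcontfun (J F) y"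
  by (simp add: jordan_hom_central_mult[OF J surj central_scalar_fun[OF assms]] bcontfun_rep_eqs)

text \<open>If the ideal of those \<open>f\<close> with \<open>J (f 1)\<close> vanishing at \<open>y\<close> had no common zero, then by
  compactness it would contain a finite sum of squares without zeros, which is invertible.\<close>

lemma ex_common_zero:
  obtains x where "\<And>f. continuous_on UNIV f \<Longrightarrow> apply_bcontfun (J (S f)) y = 0 \<Longrightarrow> f x = 0"
proof -
  have "\<exists>x. \<forall>f. continuous_on UNIV f \<longrightarrow> apply_bcontfun (J (S f)) y = 0 \<longrightarrow> f x = 0"
  proof (rule ccontr)
    assume "\<not> ?thesis"
    then obtain f where f: "continuous_on UNIV (f x)" "apply_bcontfun (J (S (f x))) y = 0" "f x x \<noteq> 0"
      for x by metis
    have "\<forall>T\<in>range (\<lambda>x. {z. f x z \<noteq> 0}). open T"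
      by (auto intro!: open_Collect_neq f continuous_on_const)
    moreover have "UNIV \<subseteq> \<Union> (range (\<lambda>x. {z. f x z \<noteq> 0}))"
      using f(3) by auto
    ultimately obtain D where D: "finite D" "UNIV \<subseteq> (\<Union>x\<in>D. {z. f x z \<noteq> 0})"
      using compactE_image[OF cX, of UNIV "\<lambda>x. {z. f x z \<noteq> 0}"] by (metis rangeI)
    define g where "g D z = (\<Sum>x\<in>D. f x z * f x z)" for D z
    have g: "continuous_on UNIV (g D)" for D
      unfolding g_def by (intro continuous_intros f)
    have "apply_bcontfun (J (S (g D))) y = 0"
      using \<open>finite D\<close>
    proof (induction D)
      case empty
      have "S (g {}) = 0"
        by (intro bcontfun_eqI) (simp add: apply_scalar_fun[OF cX g], simp add: g_def zero_bcontfun.rep_eq)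
      then show ?case by (simp add: jordan_hom_zero[OF J] zero_bcontfun.rep_eq)
    next
      case (insert x D)
      have "S (g (insert x D)) = S (f x) * S (f x) + S (g D)"
        by (intro bcontfun_eqI)
          (simp add: apply_scalar_fun[OF cX] f g bcontfun_rep_eqs plus_bcontfun.rep_eq,
            simp add: g_def insert scaleR_left_distrib)
      then show ?case
        using insert.IH f(2)[of x]
        by (simp add: jordan_hom_add[OF J] plus_bcontfun.rep_eq jordan_hom_scalar_fun_mult[OF f(1)])
    qed
    moreover have pos: "g D z > 0" for z
    proof -
      obtain x where "x \<in> D" "f x z \<noteq> 0" using D(2) by blast
      then show ?thesis
        unfolding g_def using D(1) by (intro sum_pos2[of _ x]) (auto simp: zero_less_mult_iff)
    qed
    then have "continuous_on UNIV (\<lambda>z. inverse (g D z))"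
      by (intro continuous_on_inverse g) (metis less_irrefl)
    then have "S (g D) * S (\<lambda>z. inverse (g D z)) = 1"
      using pos by (intro bcontfun_eqI)
        (simp add: apply_scalar_fun[OF cX] g bcontfun_rep_eqs less_imp_neq[THEN not_sym])
    then have "apply_bcontfun (J 1) y = apply_bcontfun (J (S (g D))) y * apply_bcontfun (J (S (\<lambda>z. inverse (g D z)))) y"
      using jordan_hom_scalar_fun_mult[OF g] by metis
    ultimately show False
      by (simp add: jordan_hom_one[OF J surj] bcontfun_rep_eqs)
  qed
  then show thesis using that by blast
qed

text \<open>If \<open>J (S ?g)\<close> has the scalar value \<open>r\<close> at \<open>y\<close>,
  then \<open>?g - r\<close> lies in the ideal with common zero \<open>x\<close>, so
  \<open>r = ?g x = 0\<close>. The factorization \<open>F = S ?g * G\<close> then makes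
  \<open>J F\<close> vanish at \<open>y\<close>.\<close>

lemma ex_point_of_evaluation:
  "\<exists>x. \<forall>F. apply_bcontfun F x = 0 \<longrightarrow> apply_bcontfun (J F) y = 0"
proof -
  obtain x where x: "\<And>f. continuous_on UNIV f \<Longrightarrow> apply_bcontfun (J (S f)) y = 0 \<Longrightarrow> f x = 0"
    using ex_common_zero by blast
  have "apply_bcontfun (J F) y = 0" if F: "apply_bcontfun F x = 0" for F
  proof -
    let ?g = "\<lambda>x. sqrt (norm (apply_bcontfun F x))"
    have g: "continuous_on UNIV ?g" by (intro continuous_intros) simp
    obtain r where r: "apply_bcontfun (J (S ?g)) y = r *\<^sub>R 1"
      using jordan_hom_scalar_fun[OF g] by blast
    have gr: "continuous_on UNIV (\<lambda>x. ?g x - r)" by (intro continuous_intros g)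
    have "S (\<lambda>x. ?g x - r) = S ?g - r *\<^sub>R 1"
      by (intro bcontfun_eqI)
        (simp add: apply_scalar_fun[OF cX] g gr minus_bcontfun.rep_eq scaleR_bcontfun.rep_eq
          bcontfun_rep_eqs scaleR_left_diff_distrib)
    then have "apply_bcontfun (J (S (\<lambda>x. ?g x - r))) y = 0"
      by (simp add: jordan_hom_diff[OF J] jordan_hom_scaleR[OF J] jordan_hom_one[OF J surj] r
          minus_bcontfun.rep_eq scaleR_bcontfun.rep_eq bcontfun_rep_eqs)
    from x[OF gr this] F have "r = 0" by simp
    moreover obtain G where "F = S ?g * G"
      using scalar_fun_divide_sqrt_norm[OF cX] by blast
    ultimately show ?thesis
      using jordan_hom_scalar_fun_mult[OF g, of G y] r by simp
  qed
  then show ?thesis by blast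
qed

lemma ex_continuous_evaluation_map:
  obtains \<phi> :: "'y \<Rightarrow> 'x" where "continuous_on UNIV \<phi>"
    "\<And>F y. apply_bcontfun F (\<phi> y) = 0 \<Longrightarrow> apply_bcontfun (J F) y = 0"
proof -
  obtain \<phi> where \<phi>: "apply_bcontfun F (\<phi> y) = 0 \<Longrightarrow> apply_bcontfun (J F) y = 0" for F y
    using ex_point_of_evaluation by metis
  have "open (\<phi> -` U)" if U: "open U" for U
  proof (subst open_subopen, intro ballI)
    fix y assume "y \<in> \<phi> -` U"
    then obtain f :: "'x \<Rightarrow> real" where f: "continuous_on UNIV f" "f (\<phi> y) = 1" "\<And>x. x \<notin> U \<Longrightarrow> f x = 0"
      using compact_t2_Urysohn[OF cX U] by (metis vimageD)
    \<comment> \<open>\<open>J (S f)\<close> takes the value \<open>1\<close> at \<open>y\<close>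
      because \<open>f\<close> does at \<open>\<phi> y\<close>, and it vanishes wherever
      \<open>\<phi>\<close> leaves \<open>U\<close>.\<close>
    let ?T = "{y'. apply_bcontfun (J (S f)) y' \<noteq> 0}"
    have "open ?T"
      by (intro open_Collect_neq continuous_on_const) simp
    moreover have "apply_bcontfun (J (S f - 1)) y = 0"
      by (rule \<phi>) (simp add: minus_bcontfun.rep_eq bcontfun_rep_eqs apply_scalar_fun[OF cX f(1)] f(2))
    then have "y \<in> ?T"
      by (simp add: jordan_hom_diff[OF J] jordan_hom_one[OF J surj] minus_bcontfun.rep_eq bcontfun_rep_eqs)
    moreover have "?T \<subseteq> \<phi> -` U"
      using \<phi>[of "S f"] f(3) by (auto simp: apply_scalar_fun[OF cX f(1)])
    ultimately show "\<exists>T. open T \<and> y \<in> T \<and> T \<subseteq> \<phi> -` U" by blast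
  qed
  then have "continuous_on UNIV \<phi>"
    by (simp add: continuous_on_open_vimage)
  with \<phi> show thesis using that by blast
qed

end

section \<open>The weighted composition form of a Jordan *-isomorphism\<close>

lemma evaluation_maps_inverse:
  fixes \<phi> :: "'y::topological_space \<Rightarrow> 'x::t2_space"
    and J :: "('x \<Rightarrow>\<^sub>C 'a::unital_cstar_algebra) \<Rightarrow> ('y \<Rightarrow>\<^sub>C 'b::unital_cstar_algebra)"
  assumes cX: "compact (UNIV :: 'x set)"
    and \<phi>: "\<And>F y. apply_bcontfun F (\<phi> y) = 0 \<Longrightarrow> apply_bcontfun (J F) y = 0"
    and \<psi>: "\<And>G x. apply_bcontfun G (\<psi> x) = 0 \<Longrightarrow> apply_bcontfun (K G) x = 0"
    and KJ: "\<And>F. K (J F) = F"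
  shows "\<phi> (\<psi> x) = x"
proof (rule ccontr)
  assume ne: "\<phi> (\<psi> x) \<noteq> x"
  obtain f :: "'x \<Rightarrow> real" where f: "continuous_on UNIV f" "f x = 1" "\<And>z. z \<notin> - {\<phi> (\<psi> x)} \<Longrightarrow> f z = 0"
    by (rule compact_t2_Urysohn[OF cX, of "- {\<phi> (\<psi> x)}" x]) (use ne in auto)
  \<comment> \<open>The zero of \<open>f\<close> at \<open>\<phi> (\<psi> x)\<close> is carried by
    \<open>J\<close> to \<open>\<psi> x\<close> and by \<open>K\<close> to \<open>x\<close>, where
    \<open>f\<close> equals \<open>1\<close>.\<close>
  have "apply_bcontfun (K (J (scalar_fun f))) x = 0"
    by (intro \<psi> \<phi>) (simp add: apply_scalar_fun[OF cX f(1)] f(3))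
  then show False
    by (simp add: KJ apply_scalar_fun[OF cX f(1)] f(2))
qed

lemma jordan_star_iso_bcontfun_imp:
  fixes J :: "('x1::t2_space \<Rightarrow>\<^sub>C 'a1::unital_cstar_algebra) \<Rightarrow>
              ('x2::t2_space \<Rightarrow>\<^sub>C 'a2::unital_cstar_algebra)"
  assumes c1: "compact (UNIV :: 'x1 set)" and c2: "compact (UNIV :: 'x2 set)"
    and p1: "prime_algebra TYPE('a1)" and p2: "prime_algebra TYPE('a2)"
    and J: "jordan_star_iso J"
  shows "\<exists>(\<phi> :: 'x2 \<Rightarrow> 'x1) (V :: 'x2 \<Rightarrow> 'a1 \<Rightarrow> 'a2).
       homeomorphism UNIV UNIV \<phi> (inv \<phi>) \<and>
       (\<forall>y. jordan_star_iso (V y)) \<and>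
       sot_continuous V \<and>
       sot_continuous (\<lambda>x. inv (V (inv \<phi> x))) \<and>
       (\<forall>F y. apply_bcontfun (J F) y = V y (apply_bcontfun F (\<phi> y)))"
proof -
  let ?K = "inv J"
  have K: "jordan_star_iso ?K" by (rule jordan_star_iso_inv[OF J])
  have JK: "J (?K G) = G" and KJ: "?K (J F) = F" for F G
    using J by (simp_all add: jordan_star_iso_def bij_is_surj bij_is_inj surj_f_inv_f)
  have hJ: "jordan_star_hom J" "surj J" and hK: "jordan_star_hom ?K" "surj ?K"
    using J K by (simp_all add: jordan_star_iso_def bij_is_surj)
  obtain \<phi> where \<phi>: "continuous_on UNIV \<phi>"
    "\<And>F y. apply_bcontfun F (\<phi> y) = 0 \<Longrightarrow> apply_bcontfun (J F) y = 0"
    using ex_continuous_evaluation_map[OF c1 p2 hJ] by blast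
  obtain \<psi> where \<psi>: "continuous_on UNIV \<psi>"
    "\<And>G x. apply_bcontfun G (\<psi> x) = 0 \<Longrightarrow> apply_bcontfun (?K G) x = 0"
    using ex_continuous_evaluation_map[OF c2 p1 hK] by blast
  have \<phi>\<psi>: "\<phi> (\<psi> x) = x" for x
    by (rule evaluation_maps_inverse[OF c1 \<phi>(2) \<psi>(2) KJ])
  have \<psi>\<phi>: "\<psi> (\<phi> y) = y" for y
    by (rule evaluation_maps_inverse[OF c2 \<psi>(2) \<phi>(2) JK])
  have inv_\<phi>: "inv \<phi> = \<psi>"
    by (rule inv_unique_comp) (auto simp: \<phi>\<psi> \<psi>\<phi>)
  define V where "V y a = apply_bcontfun (J (const_bcontfun a)) y" for y a
  have eval: "apply_bcontfun (J F) y = V y (apply_bcontfun F (\<phi> y))" for F y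
  proof -
    \<comment> \<open>Subtracting the constant function with the value of \<open>F\<close> at
      \<open>\<phi> y\<close> produces a zero there, so constants determine \<open>J F\<close> at
      \<open>y\<close>.\<close>
    have "apply_bcontfun (J (F - const_bcontfun (apply_bcontfun F (\<phi> y)))) y = 0"
      by (rule \<phi>(2)) (simp add: minus_bcontfun.rep_eq const_bcontfun.rep_eq)
    then show ?thesis
      by (simp add: jordan_hom_diff[OF hJ(1)] minus_bcontfun.rep_eq V_def)
  qed
  have "jordan_star_hom (V y)" for y
  proof -
    have "(const_bcontfun (a + b) :: 'x1 \<Rightarrow>\<^sub>C 'a1) = const_bcontfun a + const_bcontfun b"
      "(const_bcontfun (c *\<^sub>C a) :: 'x1 \<Rightarrow>\<^sub>C 'a1) = c *\<^sub>C const_bcontfun a"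
      "(const_bcontfun (jordan_prod a b) :: 'x1 \<Rightarrow>\<^sub>C 'a1) = jordan_prod (const_bcontfun a) (const_bcontfun b)"
      "(const_bcontfun (adj a) :: 'x1 \<Rightarrow>\<^sub>C 'a1) = adj (const_bcontfun a)" for a b :: 'a1 and c
      by (auto intro!: bcontfun_eqI simp: const_bcontfun.rep_eq plus_bcontfun.rep_eq
          bcontfun_rep_eqs apply_jordan_prod)
    with hJ(1) show ?thesis
      unfolding jordan_star_hom_def V_def
      by (simp add: plus_bcontfun.rep_eq bcontfun_rep_eqs apply_jordan_prod)
  qed
  moreover have V_K: "V (\<psi> x) (apply_bcontfun (?K (const_bcontfun b)) x) = b" for x b
    using eval[of "?K (const_bcontfun b)" "\<psi> x"] by (simp add: JK \<phi>\<psi> const_bcontfun.rep_eq)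
  have bij: "bij (V y)" for y
  proof (rule bijI)
    show "surj (V y)"
      using V_K[of "\<phi> y"] unfolding \<psi>\<phi> by (rule surjI)
    show "inj (V y)"
    proof (rule injI)
      fix a b assume "V y a = V y b"
      \<comment> \<open>Writing \<open>y\<close> as \<open>\<psi> (\<phi> y)\<close> lets
        \<open>\<psi>\<close> carry this zero back to \<open>\<phi> y\<close>, where the preimage
        has the value \<open>a - b\<close>.\<close>
      then have "apply_bcontfun (J (const_bcontfun a) - J (const_bcontfun b)) (\<psi> (\<phi> y)) = 0"
        by (simp add: V_def minus_bcontfun.rep_eq \<psi>\<phi>)
      from \<psi>(2)[OF this] show "a = b"
        by (simp add: jordan_hom_diff[OF hK(1)] KJ minus_bcontfun.rep_eq const_bcontfun.rep_eq)
    qed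
  qed
  ultimately have "jordan_star_iso (V y)" for y
    by (simp add: jordan_star_iso_def)
  moreover have "homeomorphism UNIV UNIV \<phi> (inv \<phi>)"
    unfolding inv_\<phi> homeomorphism_def using \<phi>(1) \<psi>(1) surjI[of \<phi> \<psi>, OF \<phi>\<psi>] surjI[of \<psi> \<phi>, OF \<psi>\<phi>]
    by (simp add: \<phi>\<psi> \<psi>\<phi>)
  moreover have "sot_continuous V"
    unfolding sot_continuous_def V_def by simp
  \<comment> \<open>The inverse fibre maps are evaluations of continuous functions, which yields
    their strong continuity.\<close>
  moreover have "inv (V (inv \<phi> x)) b = apply_bcontfun (?K (const_bcontfun b)) x" for x b
    unfolding inv_\<phi> using V_K[of x b] bij by (metis bij_inv_eq_iff)
  then have "sot_continuous (\<lambda>x. inv (V (inv \<phi> x)))"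
    unfolding sot_continuous_def by simp
  ultimately show ?thesis using eval by blast
qed

section \<open>The converse: fibrewise isomorphisms assemble to a global one\<close>

lemma sot_continuous_apply:
  fixes W :: "'x::t2_space \<Rightarrow> 'b::unital_cstar_algebra \<Rightarrow> 'a::unital_cstar_algebra"
  assumes W: "\<And>x. jordan_star_iso (W x)" and sot: "sot_continuous W" and G: "continuous_on UNIV G"
  shows "continuous_on UNIV (\<lambda>x. W x (G x))"
proof -
  have hW: "jordan_star_hom (W x)" "surj (W x)" for x
    using W[of x] by (simp_all add: jordan_star_iso_def bij_is_surj)
  have "isCont (\<lambda>x. W x (G x)) x" for x
  proof -
    have lim: "(G \<longlongrightarrow> G x) (at x)" "((\<lambda>z. W z (G x)) \<longlongrightarrow> W x (G x)) (at x)"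
      using G sot by (simp_all add: sot_continuous_def continuous_on_eq_continuous_at isCont_def)
    \<comment> \<open>\<open>W z (G z)\<close> splits into \<open>W z (G z - G x)\<close>,
      controlled by the uniform bound on Jordan *-isomorphisms, and \<open>W z (G x)\<close>,
      controlled by strong continuity.\<close>
    have "((\<lambda>z. 2 * norm (G z - G x)) \<longlongrightarrow> 0) (at x)"
      by (intro tendsto_mult_right_zero tendsto_norm_zero) (simp add: lim LIM_zero)
    then have "((\<lambda>z. W z (G z - G x)) \<longlongrightarrow> 0) (at x)"
      by (rule Lim_null_comparison[rotated]) (simp add: norm_jordan_hom_le[OF hW])
    from tendsto_add[OF this lim(2)] show ?thesis
      by (simp add: isCont_def jordan_hom_diff[OF hW(1)])
  qed
  then show ?thesis by (simp add: continuous_on_eq_continuous_at)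
qed

lemma jordan_star_iso_bcontfunI:
  fixes J :: "('x1::t2_space \<Rightarrow>\<^sub>C 'a1::unital_cstar_algebra) \<Rightarrow>
              ('x2::t2_space \<Rightarrow>\<^sub>C 'a2::unital_cstar_algebra)"
  assumes c1: "compact (UNIV :: 'x1 set)"
    and \<phi>: "homeomorphism UNIV UNIV \<phi> (inv \<phi>)"
    and V: "\<forall>y. jordan_star_iso (V y)"
    and sot: "sot_continuous (\<lambda>x. inv (V (inv \<phi> x)))"
    and eval: "\<forall>F y. apply_bcontfun (J F) y = V y (apply_bcontfun F (\<phi> y))"
  shows "jordan_star_iso J"
proof -
  have hV: "jordan_star_hom (V y)" and bV: "bij (V y)" for y
    using V by (simp_all add: jordan_star_iso_def)
  have inv: "\<phi> (inv \<phi> x) = x" "inv \<phi> (\<phi> y) = y" for x y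
    using \<phi> by (auto simp: homeomorphism_def)
  have "jordan_star_hom J"
    using hV unfolding jordan_star_hom_def
    by (auto intro!: bcontfun_eqI simp: eval plus_bcontfun.rep_eq bcontfun_rep_eqs apply_jordan_prod)
  moreover have "inj J"
  proof (rule injI)
    fix F G assume FG: "J F = J G"
    show "F = G"
    proof (rule bcontfun_eqI)
      fix x
      have "V (inv \<phi> x) (apply_bcontfun F x) = V (inv \<phi> x) (apply_bcontfun G x)"
        using eval FG inv by metis
      then show "apply_bcontfun F x = apply_bcontfun G x"
        using bij_is_inj[OF bV] by (meson injD)
    qed
  qed
  moreover have "surj J"
  proof (rule surjI)
    fix G
    \<comment> \<open>Solving the evaluation formula at \<open>y = inv \<phi> x\<close> forces this
      preimage; its continuity remains to be shown.\<close>
    let ?F = "\<lambda>x. inv (V (inv \<phi> x)) (apply_bcontfun G (inv \<phi> x))"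
    have "continuous_on UNIV (inv \<phi>)"
      using \<phi> by (simp add: homeomorphism_def)
    then have "continuous_on UNIV (\<lambda>x. apply_bcontfun G (inv \<phi> x))"
      by (rule continuous_on_compose2[OF continuous_on_apply_bcontfun[of UNIV G]]) simp
    moreover have "jordan_star_iso (inv (V (inv \<phi> x)))" for x
      using V by (simp add: jordan_star_iso_inv)
    ultimately have "continuous_on UNIV ?F"
      using sot_continuous_apply[of "\<lambda>x. inv (V (inv \<phi> x))" "\<lambda>x. apply_bcontfun G (inv \<phi> x)"] sot
      by blast
    then have F: "apply_bcontfun (Bcontfun ?F) = ?F"
      by (rule apply_Bcontfun_compact[OF c1])
    show "J (Bcontfun ?F) = G"
      by (rule bcontfun_eqI) (simp add: eval F inv surj_f_inv_f bij_is_surj[OF bV])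
  qed
  ultimately show ?thesis
    by (simp add: jordan_star_iso_def bij_def)
qed

theorem theorem2p8:
  fixes J :: "('x1::t2_space \<Rightarrow>\<^sub>C 'a1::unital_cstar_algebra) \<Rightarrow>
              ('x2::t2_space \<Rightarrow>\<^sub>C 'a2::unital_cstar_algebra)"
  assumes "compact (UNIV :: 'x1 set)"
    and "compact (UNIV :: 'x2 set)"
    and "primitive_algebra TYPE('h1::complex_hilbert_space) TYPE('a1)"
    and "primitive_algebra TYPE('h2::complex_hilbert_space) TYPE('a2)"
  shows "jordan_star_iso J \<longleftrightarrow>
    (\<exists>(\<phi> :: 'x2 \<Rightarrow> 'x1) (V :: 'x2 \<Rightarrow> 'a1 \<Rightarrow> 'a2).
       homeomorphism UNIV UNIV \<phi> (inv \<phi>) \<and>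
       (\<forall>y. jordan_star_iso (V y)) \<and>
       sot_continuous V \<and>
       sot_continuous (\<lambda>x. inv (V (inv \<phi> x))) \<and>
       (\<forall>F y. apply_bcontfun (J F) y = V y (apply_bcontfun F (\<phi> y))))"
proof (intro iffI)
  assume "jordan_star_iso J"
  with assms(1,2) primitive_imp_prime_algebra[OF assms(3)] primitive_imp_prime_algebra[OF assms(4)]
  show "\<exists>(\<phi> :: 'x2 \<Rightarrow> 'x1) (V :: 'x2 \<Rightarrow> 'a1 \<Rightarrow> 'a2).
       homeomorphism UNIV UNIV \<phi> (inv \<phi>) \<and>
       (\<forall>y. jordan_star_iso (V y)) \<and>
       sot_continuous V \<and>
       sot_continuous (\<lambda>x. inv (V (inv \<phi> x))) \<and>
       (\<forall>F y. apply_bcontfun (J F) y = V y (apply_bcontfun F (\<phi> y)))"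
    by (rule jordan_star_iso_bcontfun_imp)
qed (elim exE conjE, rule jordan_star_iso_bcontfunI[OF assms(1)])

end
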